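(* Let $(S,\circ)$ be a right gyrogroup with identity $e$, let $G_S$ be its right inner mapping group, let $x\in S\setminus\{e\}$, $a\in G_S\setminus\{I_S\}$ and $m,n\in\mathbb{N}=\{1,2,\dots\}$. With $\beta^r(x,a)\in S$ and $g^r(x,a)\in G_S$ as defined in the context, the shared common key of the key exchange protocol is $$\big(\beta^n(x,a)\,\theta\, g^m(x,a)\big)\circ\beta^m(x,a)=\big(\beta^m(x,a)\,\theta\, g^n(x,a)\big)\circ\beta^n(x,a)=\beta^{m+n}(x,a),$$ where, for every $k\in\mathbb{N}$, $$\beta^k(x,a)=\big[\big(\cdots\big((x\theta a^{k-1}\circ x\theta a^{k-2})\circ x\theta a^{k-3}\big)\cdots\big)\circ x\theta a\big]\circ x,$$ i.e. $\beta^k(x,a)$ is the left-bracketed $\circ$-product of $x\theta a^{k-1},x\theta a^{k-2},\dots,x\theta a,x$ in this order (for $k=1$ it is $x$).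
   Context: A right loop is a set $S$ with a binary operation $\circ$ and a two-sided identity $e$ such that for all $x,y\in S$ the equation $X\circ x=y$ has a unique solution $X\in S$; $x'$ denotes the element with $x'\circ x=e$. For $y,z\in S$ the right inner mapping $f(y,z)$ is the permutation of $S$ (fixing $e$) determined by $f(y,z)(x)\circ(y\circ z)=(x\circ y)\circ z$ for all $x\in S$. $G_S$ is the subgroup of the group of permutations of $S$ fixing $e$ generated by all $f(y,z)$, and $I_S$ is the identity map of $S$. A right gyrogroup is a right loop such that $f(y,z)$ is an automorphism of $(S,\circ)$ for all $y,z\in S$ and $f(x',x)=I_S$ for all $x\in S$. Write $x\theta h=h(x)$; products of permutations are taken so that $\theta$ is a right action: $x\theta(hk)=(x\theta h)\theta k$ (apply $h$ first). The action $\theta$ binds more tightly than $\circ$. For $h\in G_S$ and $y\in S$, $\sigma_y(h)$ is the permutation of $S$ fixing $e$ determined by $(x\circ y)\theta h=(x\theta\sigma_y(h))\circ(y\theta h)$ for all $x\in S$ (it is known to lie in $G_S$). For $x\in S$, $a\in G_S$ define recursively $\beta^1(x,a)=x$, $\beta^{r+1}(x,a)=(\beta^r(x,a)\theta a)\circ x$, and $g^1(x,a)=a$, $g^{r+1}(x,a)=g^r(x,a)\,\sigma_{\beta^r(x,a)}(a)\,f(\beta^r(x,a)\theta a,\,x)$. In the protocol, one party holds $g^m(x,a),\beta^m(x,a)$ and receives $\beta^n(x,a)$, the other holds $g^n(x,a),\beta^n(x,a)$ and receives $\beta^m(x,a)$; their keys are the two expressions displayed first in the claim. *)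

theory Defs
  imports "HOL-Algebra.Bij" "HOL-Algebra.Generated_Groups"
begin

locale right_loop =
  fixes S (structure)
  assumes op_closed: "\<lbrakk>x \<in> carrier S; y \<in> carrier S\<rbrakk> \<Longrightarrow> x \<otimes> y \<in> carrier S"
    and id_closed: "\<one> \<in> carrier S"
    and id_left: "x \<in> carrier S \<Longrightarrow> \<one> \<otimes> x = x"
    and id_right: "x \<in> carrier S \<Longrightarrow> x \<otimes> \<one> = x"
    and right_solvable:
      "\<lbrakk>x \<in> carrier S; y \<in> carrier S\<rbrakk> \<Longrightarrow> \<exists>!X. X \<in> carrier S \<and> X \<otimes> x = y"

definition left_inv :: "('s, 'm) monoid_scheme \<Rightarrow> 's \<Rightarrow> 's" where
  "left_inv S x = (THE x'. x' \<in> carrier S \<and> x' \<otimes>\<^bsub>S\<^esub> x = \<one>\<^bsub>S\<^esub>)"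

text \<open>The action of permutations is written on the right, so in a product of permutations
  the left factor is applied first; this is opposite to the convention of \<^const>\<open>BijGroup\<close>.\<close>

abbreviation (input) perm_act :: "'s \<Rightarrow> ('s \<Rightarrow> 's) \<Rightarrow> 's"  (infixl "\<theta>" 75) where
  "x \<theta> h \<equiv> h x"

definition perm_group :: "('s, 'm) monoid_scheme \<Rightarrow> ('s \<Rightarrow> 's) monoid" where
  "perm_group S =
    \<lparr>carrier = {h \<in> Bij (carrier S). \<one>\<^bsub>S\<^esub> \<theta> h = \<one>\<^bsub>S\<^esub>},
     mult = (\<lambda>h k. \<lambda>x\<in>carrier S. (x \<theta> h) \<theta> k),
     one = (\<lambda>x\<in>carrier S. x)\<rparr>"

definition inner_map :: "('s, 'm) monoid_scheme \<Rightarrow> 's \<Rightarrow> 's \<Rightarrow> 's \<Rightarrow> 's" where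
  "inner_map S y z =
    (THE k. k \<in> carrier (perm_group S) \<and>
      (\<forall>x\<in>carrier S. (x \<theta> k) \<otimes>\<^bsub>S\<^esub> (y \<otimes>\<^bsub>S\<^esub> z) = (x \<otimes>\<^bsub>S\<^esub> y) \<otimes>\<^bsub>S\<^esub> z))"

definition inner_mapping_group :: "('s, 'm) monoid_scheme \<Rightarrow> ('s \<Rightarrow> 's) monoid" where
  "inner_mapping_group S =
    (perm_group S)
      \<lparr>carrier := generate (perm_group S) {inner_map S y z | y z. y \<in> carrier S \<and> z \<in> carrier S}\<rparr>"

locale right_gyrogroup = right_loop +
  assumes inner_map_auto:
      "\<lbrakk>y \<in> carrier S; z \<in> carrier S\<rbrakk> \<Longrightarrow> inner_map S y z \<in> auto S"
    and inner_map_left_inv: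
      "x \<in> carrier S \<Longrightarrow> inner_map S (left_inv S x) x = (\<lambda>u\<in>carrier S. u)"

definition sigma :: "('s, 'm) monoid_scheme \<Rightarrow> 's \<Rightarrow> ('s \<Rightarrow> 's) \<Rightarrow> 's \<Rightarrow> 's" where
  "sigma S y h =
    (THE k. k \<in> carrier (perm_group S) \<and>
      (\<forall>x\<in>carrier S. (x \<otimes>\<^bsub>S\<^esub> y) \<theta> h = x \<theta> k \<otimes>\<^bsub>S\<^esub> y \<theta> h))"

text \<open>Both sequences are indexed from 1; the value at 0 is irrelevant.\<close>

fun beta :: "('s, 'm) monoid_scheme \<Rightarrow> nat \<Rightarrow> 's \<Rightarrow> ('s \<Rightarrow> 's) \<Rightarrow> 's" where
  "beta S 0 x a = undefined"
| "beta S (Suc 0) x a = x"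
| "beta S (Suc (Suc r)) x a = beta S (Suc r) x a \<theta> a \<otimes>\<^bsub>S\<^esub> x"

fun gseq :: "('s, 'm) monoid_scheme \<Rightarrow> nat \<Rightarrow> 's \<Rightarrow> ('s \<Rightarrow> 's) \<Rightarrow> 's \<Rightarrow> 's" where
  "gseq S 0 x a = undefined"
| "gseq S (Suc 0) x a = a"
| "gseq S (Suc (Suc r)) x a =
    gseq S (Suc r) x a
      \<otimes>\<^bsub>inner_mapping_group S\<^esub> sigma S (beta S (Suc r) x a) a
      \<otimes>\<^bsub>inner_mapping_group S\<^esub> inner_map S (beta S (Suc r) x a \<theta> a) x"

text \<open>\<open>left_prod S u k\<close> is the left-bracketed product
  \<open>(\<dots>((u (k-1) \<otimes> u (k-2)) \<otimes> u (k-3)) \<dots> \<otimes> u 1) \<otimes> u 0\<close>, for \<open>k \<ge> 1\<close>.\<close>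

definition left_prod :: "('s, 'm) monoid_scheme \<Rightarrow> (nat \<Rightarrow> 's) \<Rightarrow> nat \<Rightarrow> 's" where
  "left_prod S u k = foldl (\<otimes>\<^bsub>S\<^esub>) (u (k - 1)) (map u (rev [0..<k - 1]))"

end

theory Submission
  imports Defs
begin

text \<open>Every \<open>a\<close> in the inner mapping group is an automorphism, so \<open>\<sigma>\<^sub>y(a) = a\<close>.
  Put \<open>T y = (y \<theta> a) \<circ> x\<close>. Then \<open>\<beta>\<^sup>r = T\<^sup>r e\<close>, and by the defining property of the inner
  maps \<open>(y \<theta> g\<^sup>r) \<circ> \<beta>\<^sup>r = T\<^sup>r y\<close> for all \<open>y\<close>. Both keys are therefore \<open>T\<^bsup>m+n\<^esup> e\<close>.\<close>

section \<open>Permutations that fix the identity\<close>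

lemma carrier_perm_group: "carrier (perm_group S) = {h \<in> Bij (carrier S). h \<one>\<^bsub>S\<^esub> = \<one>\<^bsub>S\<^esub>}"
  by (simp add: perm_group_def)

lemma perm_group_closed: "\<lbrakk>h \<in> carrier (perm_group S); x \<in> carrier S\<rbrakk> \<Longrightarrow> h x \<in> carrier S"
  by (auto simp: carrier_perm_group dest: Bij_imp_funcset)

text \<open>Members of \<open>Bij\<close> are extensional, so their values on the carrier determine
  them as total functions. This gives the uniqueness behind the descriptions of
  \<open>inner_map\<close> and \<open>sigma\<close>.\<close>

lemma perm_eqI:
  assumes "h \<in> carrier (perm_group S)" "k \<in> carrier (perm_group S)"
    and "\<And>x. x \<in> carrier S \<Longrightarrow> h x = k x"
  shows "h = k"
  using assms(1,2)
  by (intro extensionalityI[OF _ _ assms(3)]) (simp_all add: carrier_perm_group Bij_imp_extensional)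

lemma perm_group_mult:
  "x \<in> carrier S \<Longrightarrow> (h \<otimes>\<^bsub>perm_group S\<^esub> k) x = k (h x)"
  by (simp add: perm_group_def)

lemma inner_mapping_group_mult:
  "x \<in> carrier S \<Longrightarrow> (h \<otimes>\<^bsub>inner_mapping_group S\<^esub> k) x = k (h x)"
  by (simp add: inner_mapping_group_def perm_group_def)

lemma inner_mapping_group_one: "x \<in> carrier S \<Longrightarrow> \<one>\<^bsub>inner_mapping_group S\<^esub> x = x"
  by (simp add: inner_mapping_group_def perm_group_def)

section \<open>Left-bracketed products\<close>

lemma left_prod_Suc_0: "left_prod S u (Suc 0) = u 0"
  by (simp add: left_prod_def)

text \<open>Splitting off the last factor, which has index 0, shifts the remaining indices by one.
  This is the shape of the recursion of \<open>beta\<close>, which multiplies by \<open>x\<close> on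
  the right.\<close>

lemma left_prod_Suc_Suc:
  "left_prod S u (Suc (Suc k)) = left_prod S (\<lambda>i. u (Suc i)) (Suc k) \<otimes>\<^bsub>S\<^esub> u 0"
proof -
  have "[0..<Suc k] = 0 # map Suc [0..<k]"
    by (simp add: map_Suc_upt upt_conv_Cons del: upt_Suc)
  then have "map u (rev [0..<Suc k]) = map (\<lambda>i. u (Suc i)) (rev [0..<k]) @ [u 0]"
    by (simp add: rev_map comp_def del: upt_Suc)
  then show ?thesis
    by (simp add: left_prod_def del: upt_Suc)
qed

section \<open>Right loops: cancellation, inner maps and \<open>sigma\<close>\<close>

context right_loop
begin

lemma group_perm_group: "group (perm_group S)"
proof (rule groupI)
  show closed: "h \<otimes>\<^bsub>perm_group S\<^esub> k \<in> carrier (perm_group S)"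
    if "h \<in> carrier (perm_group S)" "k \<in> carrier (perm_group S)" for h k
  proof -
    \<comment> \<open>The product in \<open>perm_group\<close> applies \<open>h\<close> first, hence
      the swapped arguments of \<open>compose\<close>.\<close>
    have "compose (carrier S) k h \<in> Bij (carrier S)"
      using that by (simp add: carrier_perm_group compose_Bij)
    then show ?thesis
      using that by (simp add: perm_group_def compose_def id_closed)
  qed
  show one: "\<one>\<^bsub>perm_group S\<^esub> \<in> carrier (perm_group S)"
    by (simp add: perm_group_def id_Bij id_closed)
  fix h assume h: "h \<in> carrier (perm_group S)"
  show "h \<otimes>\<^bsub>perm_group S\<^esub> k \<otimes>\<^bsub>perm_group S\<^esub> l = h \<otimes>\<^bsub>perm_group S\<^esub> (k \<otimes>\<^bsub>perm_group S\<^esub> l)"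
    if "k \<in> carrier (perm_group S)" "l \<in> carrier (perm_group S)" for k l
    using h that by (intro perm_eqI[of _ S] closed) (simp_all add: perm_group_mult perm_group_closed)
  show "\<one>\<^bsub>perm_group S\<^esub> \<otimes>\<^bsub>perm_group S\<^esub> h = h"
    using h one by (intro perm_eqI[of _ S] closed) (simp_all add: perm_group_def)
  let ?k = "\<lambda>x\<in>carrier S. inv_into (carrier S) h x"
  have bij: "bij_betw h (carrier S) (carrier S)"
    using h by (simp add: carrier_perm_group Bij_def)
  then have "?k \<one> = \<one>"
    using h id_closed inv_into_f_f[of h "carrier S" \<one>]
    by (auto simp: carrier_perm_group bij_betw_def)
  then have "?k \<in> carrier (perm_group S)"
    using h by (simp add: carrier_perm_group restrict_inv_into_Bij)
  moreover have "?k \<otimes>\<^bsub>perm_group S\<^esub> h = \<one>\<^bsub>perm_group S\<^esub>"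
    using bij by (auto simp: perm_group_def bij_betw_def f_inv_into_f)
  ultimately show "\<exists>k\<in>carrier (perm_group S). k \<otimes>\<^bsub>perm_group S\<^esub> h = \<one>\<^bsub>perm_group S\<^esub>"
    by blast
qed

lemma right_cancel:
  "\<lbrakk>u \<in> carrier S; v \<in> carrier S; x \<in> carrier S; u \<otimes> x = v \<otimes> x\<rbrakk> \<Longrightarrow> u = v"
  using right_solvable[of x "v \<otimes> x"] op_closed by blast

lemma bij_right_mult:
  assumes x: "x \<in> carrier S"
  shows "bij_betw (\<lambda>u. u \<otimes> x) (carrier S) (carrier S)"
  unfolding bij_betw_def
proof (intro conjI equalityI)
  show "inj_on (\<lambda>u. u \<otimes> x) (carrier S)"
    using x right_cancel by (meson inj_onI)
  show "carrier S \<subseteq> (\<lambda>u. u \<otimes> x) ` carrier S"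
    using x right_solvable[of x] by blast
qed (use x op_closed in blast)

text \<open>The image of \<open>\<one>\<close> under an automorphism is idempotent, and right
  cancellation leaves \<open>\<one>\<close> as the only idempotent.\<close>

lemma auto_subset_perm_group: "auto S \<subseteq> carrier (perm_group S)"
proof
  fix h assume h: "h \<in> auto S"
  then have "h \<in> hom S S" "h \<in> Bij (carrier S)"
    by (auto simp: auto_def)
  moreover from this have "h \<one> \<in> carrier S" "h \<one> \<otimes> h \<one> = \<one> \<otimes> h \<one>"
    using id_closed hom_mult[of h S S \<one> \<one>] hom_in_carrier[of h S S \<one>]
    by (simp_all add: id_left)
  ultimately show "h \<in> carrier (perm_group S)"
    using right_cancel id_closed by (auto simp: carrier_perm_group)
qed

text \<open>Since \<open>inner_map\<close> is a definite description, its defining equation becomes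
  available only after existence and uniqueness. Both come from the bijectivity of right
  multiplications.\<close>

lemma inner_map_properties:
  assumes y: "y \<in> carrier S" and z: "z \<in> carrier S"
  shows inner_map_perm: "inner_map S y z \<in> carrier (perm_group S)"
    and inner_map_eq: "x \<in> carrier S \<Longrightarrow> inner_map S y z x \<otimes> (y \<otimes> z) = (x \<otimes> y) \<otimes> z"
proof -
  let ?R = "\<lambda>x u. u \<otimes> x"
  let ?P = "\<lambda>k. k \<in> carrier (perm_group S) \<and> (\<forall>x\<in>carrier S. k x \<otimes> (y \<otimes> z) = (x \<otimes> y) \<otimes> z)"
  have yz: "y \<otimes> z \<in> carrier S"
    using y z by (rule op_closed)
  \<comment> \<open>The witness solves the defining equation pointwise: multiply by
    \<open>y\<close>, then by \<open>z\<close>, then undo the multiplication by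
    \<open>y \<otimes> z\<close>.\<close>
  define k where "k = (\<lambda>x\<in>carrier S. inv_into (carrier S) (?R (y \<otimes> z)) ((x \<otimes> y) \<otimes> z))"
  have k_eq: "k x \<otimes> (y \<otimes> z) = (x \<otimes> y) \<otimes> z" if "x \<in> carrier S" for x
    using that y z bij_betw_inv_into_right[OF bij_right_mult[OF yz], of "(x \<otimes> y) \<otimes> z"]
    by (simp add: k_def op_closed)
  have "bij_betw (inv_into (carrier S) (?R (y \<otimes> z)) \<circ> (?R z \<circ> ?R y)) (carrier S) (carrier S)"
    by (rule bij_betw_trans[OF bij_betw_trans[OF bij_right_mult[OF y] bij_right_mult[OF z]]
          bij_betw_inv_into[OF bij_right_mult[OF yz]]])
  then have bij: "bij_betw k (carrier S) (carrier S)"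
    by (rule bij_betw_cong[THEN iffD1, rotated]) (simp add: k_def)
  then have "k \<one> \<in> carrier S"
    using id_closed by (rule bij_betw_apply)
  \<comment> \<open>Both sides solve
    \<open>X \<otimes> (y \<otimes> z) = y \<otimes> z\<close>.\<close>
  then have "k \<one> = \<one>"
    using k_eq[OF id_closed] y yz by (simp add: right_cancel[of _ _ "y \<otimes> z"] id_closed id_left)
  moreover have "k \<in> extensional (carrier S)"
    by (simp add: k_def)
  ultimately have k: "?P k"
    using bij k_eq by (simp add: carrier_perm_group Bij_def)
  moreover have "l = k" if l: "?P l" for l
  proof (rule perm_eqI[of _ S])
    fix x assume x: "x \<in> carrier S"
    show "l x = k x"
    proof (rule right_cancel[OF _ _ yz])
      show "l x \<in> carrier S" "k x \<in> carrier S" "l x \<otimes> (y \<otimes> z) = k x \<otimes> (y \<otimes> z)"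
        using k l x perm_group_closed[of _ S x] by simp_all
    qed
  qed (use k l in blast)+
  ultimately have "?P (inner_map S y z)"
    unfolding inner_map_def by (rule theI[of ?P])
  then show "inner_map S y z \<in> carrier (perm_group S)"
    and "x \<in> carrier S \<Longrightarrow> inner_map S y z x \<otimes> (y \<otimes> z) = (x \<otimes> y) \<otimes> z"
    by simp_all
qed

text \<open>The homomorphism law says that \<open>a\<close> satisfies the equation describing
  \<open>sigma S y a\<close>; cancelling \<open>a y\<close> on the right shows that nothing else
  does.\<close>

lemma sigma_auto:
  assumes a: "a \<in> auto S" and y: "y \<in> carrier S"
  shows "sigma S y a = a"
proof -
  have hom: "a \<in> hom S S" and perm: "a \<in> carrier (perm_group S)"
    using a auto_subset_perm_group by (auto simp: auto_def)
  show ?thesis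
    unfolding sigma_def
  proof (rule the_equality)
    fix k assume k: "k \<in> carrier (perm_group S) \<and> (\<forall>x\<in>carrier S. a (x \<otimes> y) = k x \<otimes> a y)"
    show "k = a"
    proof (rule perm_eqI[of _ S])
      fix x assume x: "x \<in> carrier S"
      show "k x = a x"
      proof (rule right_cancel)
        show "k x \<in> carrier S" "a x \<in> carrier S" "a y \<in> carrier S" "k x \<otimes> a y = a x \<otimes> a y"
          using k x perm perm_group_closed[of _ S] y hom_mult[OF hom x y] by simp_all
      qed
    qed (use k perm in blast)+
  qed (use hom perm y in \<open>simp add: hom_mult\<close>)
qed

text \<open>Closure is proved in the same induction because applying the homomorphism law to the
  last multiplication requires the shorter product to lie in the carrier.\<close>

lemma hom_left_prod:
  assumes "a \<in> hom S S" "\<And>i. u i \<in> carrier S"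
  shows "left_prod S u (Suc k) \<in> carrier S \<and> a (left_prod S u (Suc k)) = left_prod S (\<lambda>i. a (u i)) (Suc k)"
  using assms(2)
proof (induction k arbitrary: u)
  case (Suc k)
  then show ?case
    using Suc.IH[of "\<lambda>i. u (Suc i)"] assms(1)
    by (simp add: left_prod_Suc_Suc hom_mult op_closed)
qed (simp add: left_prod_Suc_0)

section \<open>Iterating \<open>y \<mapsto> a y \<otimes> x\<close> for a fixed automorphism
  \<open>a\<close>\<close>

context
  fixes x a
  assumes x: "x \<in> carrier S" and a: "a \<in> auto S"
begin

lemma a_hom: "a \<in> hom S S"
  using a by (simp add: auto_def)

lemma a_closed: "y \<in> carrier S \<Longrightarrow> a y \<in> carrier S"
  using a_hom by (rule hom_in_carrier)

text \<open>The iteration may start at \<open>\<one>\<close> because \<open>a\<close> fixes it, so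
  the first step yields \<open>x\<close>.\<close>

lemma beta_funpow: "beta S (Suc r) x a = ((\<lambda>y. a y \<otimes> x) ^^ Suc r) \<one>"
proof (induction r)
  case 0
  then show ?case
    using auto_subset_perm_group a x by (auto simp: carrier_perm_group id_left)
qed simp

lemma beta_closed: "beta S (Suc r) x a \<in> carrier S"
  by (induction r) (simp_all add: x a_closed op_closed)

lemma gseq_closed: "y \<in> carrier S \<Longrightarrow> gseq S (Suc r) x a y \<in> carrier S"
  by (induction r)
    (simp_all add: a_closed inner_mapping_group_mult sigma_auto[OF a] beta_closed x
      perm_group_closed[OF inner_map_perm])

lemma gseq_beta:
  assumes y: "y \<in> carrier S"
  shows "gseq S (Suc r) x a y \<otimes> beta S (Suc r) x a = ((\<lambda>y. a y \<otimes> x) ^^ Suc r) y"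
proof (induction r)
  case (Suc r)
  let ?b = "beta S (Suc r) x a" and ?g = "gseq S (Suc r) x a"
  \<comment> \<open>With \<open>sigma\<close> replaced by \<open>a\<close>, the recursion applies
    \<open>?g\<close>, then \<open>a\<close>, then the inner map.\<close>
  have "gseq S (Suc (Suc r)) x a y \<otimes> beta S (Suc (Suc r)) x a
      = inner_map S (a ?b) x (a (?g y)) \<otimes> (a ?b \<otimes> x)"
    using y by (simp add: inner_mapping_group_mult sigma_auto[OF a] beta_closed)
  \<comment> \<open>The inner map rebrackets to
    \<open>(a (?g y) \<otimes> a ?b) \<otimes> x\<close>, and the homomorphism law pulls
    \<open>a\<close> out.\<close>
  also have "\<dots> = a (?g y \<otimes> ?b) \<otimes> x"
    using y by (simp add: inner_map_eq x a_closed beta_closed gseq_closed hom_mult[OF a_hom])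
  finally show ?case
    using Suc by simp
qed simp

text \<open>Applying \<open>a\<close> to the product for \<open>k\<close> raises every exponent by
  one, and the new factor \<open>x\<close> takes exponent 0.\<close>

lemma beta_left_prod:
  "beta S (Suc k) x a = left_prod S (\<lambda>i. (a [^]\<^bsub>inner_mapping_group S\<^esub> i) x) (Suc k)"
proof (induction k)
  case 0
  then show ?case
    by (simp add: left_prod_Suc_0 inner_mapping_group_one x)
next
  case (Suc k)
  have "(a [^]\<^bsub>inner_mapping_group S\<^esub> i) x \<in> carrier S" for i :: nat
    by (induction i) (simp_all add: inner_mapping_group_one inner_mapping_group_mult x a_closed)
  then show ?case
    using Suc
    by (simp add: left_prod_Suc_Suc inner_mapping_group_one inner_mapping_group_mult x
        hom_left_prod[OF a_hom])
qed

end

end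

text \<open>The generators are automorphisms by the gyrogroup axiom, and automorphisms are closed
  under products and inverses in \<open>perm_group\<close>. This lets the results for automorphisms
  apply to the \<open>a\<close> of the theorem.\<close>

lemma (in right_gyrogroup) inner_mapping_group_auto:
  "carrier (inner_mapping_group S) \<subseteq> auto S"
proof
  interpret P: group "perm_group S"
    by (rule group_perm_group)
  let ?F = "{inner_map S y z | y z. y \<in> carrier S \<and> z \<in> carrier S}"
  have auto_inv: "inv\<^bsub>perm_group S\<^esub> h \<in> auto S" if h: "h \<in> auto S" for h
  proof -
    let ?i = "inv\<^bsub>perm_group S\<^esub> h"
    have hp: "h \<in> carrier (perm_group S)" and hom: "h \<in> hom S S"
      using h auto_subset_perm_group by (auto simp: auto_def)
    then have ip: "?i \<in> carrier (perm_group S)"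
      by simp
    have hi: "h (?i u) = u" and ih: "?i (h u) = u" if "u \<in> carrier S" for u
      using that P.l_inv[OF hp] P.r_inv[OF hp] perm_group_mult[OF that, of ?i h]
        perm_group_mult[OF that, of h ?i] by (simp_all add: perm_group_def)
    have "?i (u \<otimes> v) = ?i u \<otimes> ?i v" if "u \<in> carrier S" "v \<in> carrier S" for u v
    proof -
      \<comment> \<open>Applying \<open>?i\<close> to both sides gives the homomorphism law for the
        inverse.\<close>
      have "u \<otimes> v = h (?i u \<otimes> ?i v)"
        using that ip hom by (simp add: hom_mult perm_group_closed hi)
      then show ?thesis
        using that ip by (simp add: ih op_closed perm_group_closed)
    qed
    then show ?thesis
      using ip by (auto simp: auto_def carrier_perm_group hom_def dest: Bij_imp_funcset)
  qed
  fix h assume "h \<in> carrier (inner_mapping_group S)"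
  then have "h \<in> generate (perm_group S) ?F"
    by (simp add: inner_mapping_group_def)
  then show "h \<in> auto S"
  proof (induction rule: generate.induct)
    case one
    have "(\<lambda>u\<in>carrier S. u) \<in> auto S"
      by (simp add: auto_def hom_def id_Bij op_closed)
    moreover have "\<one>\<^bsub>perm_group S\<^esub> = (\<lambda>u\<in>carrier S. u)"
      by (simp add: perm_group_def)
    ultimately show ?case
      by (simp only:)
  next
    case (incl h)
    then show ?case
      by (auto intro: inner_map_auto)
  next
    case (inv h)
    then show ?case
      by (auto intro: inner_map_auto auto_inv)
  next
    case (eng h k)
    then have hom: "h \<in> hom S S" "k \<in> hom S S"
      by (auto simp: auto_def)
    have "h \<otimes>\<^bsub>perm_group S\<^esub> k \<in> carrier (perm_group S)"
      using eng auto_subset_perm_group P.m_closed by (meson subsetD)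
    moreover have "h \<otimes>\<^bsub>perm_group S\<^esub> k \<in> hom S S"
      using hom by (auto simp: hom_def perm_group_mult op_closed Pi_iff)
    ultimately show ?case
      by (simp add: auto_def carrier_perm_group)
  qed
qed

theorem corollary4p2:
  fixes S :: "('s, 'm) monoid_scheme" (structure)
    and x :: 's and a :: "'s \<Rightarrow> 's" and m n :: nat
  assumes "right_gyrogroup S"
    and "x \<in> carrier S - {\<one>}"
    and "a \<in> carrier (inner_mapping_group S) - {\<one>\<^bsub>inner_mapping_group S\<^esub>}"
    and "m \<ge> 1" and "n \<ge> 1"
  shows "beta S n x a \<theta> gseq S m x a \<otimes> beta S m x a = beta S m x a \<theta> gseq S n x a \<otimes> beta S n x a
    \<and> beta S m x a \<theta> gseq S n x a \<otimes> beta S n x a = beta S (m + n) x a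
    \<and> (\<forall>k\<ge>1. beta S k x a = left_prod S (\<lambda>i. x \<theta> (a [^]\<^bsub>inner_mapping_group S\<^esub> i)) k)"
proof -
  interpret right_gyrogroup S
    by fact
  let ?T = "\<lambda>y. a y \<otimes> x"
  have x: "x \<in> carrier S" and a: "a \<in> auto S"
    using assms(2,3) inner_mapping_group_auto by auto
  have beta: "beta S r x a = (?T ^^ r) \<one>" if "r \<ge> 1" for r
    using that beta_funpow[OF x a] by (cases r) auto
  have gseq: "gseq S r x a y \<otimes> beta S r x a = (?T ^^ r) y" if "r \<ge> 1" "y \<in> carrier S" for r y
    using that gseq_beta[OF x a] by (cases r) auto
  have closed: "beta S r x a \<in> carrier S" if "r \<ge> 1" for r
    using that beta_closed[OF x a] by (cases r) auto
  have key: "gseq S r x a (beta S s x a) \<otimes> beta S r x a = beta S (r + s) x a"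
    if "r \<ge> 1" "s \<ge> 1" for r s
    \<comment> \<open>The first pass must keep \<open>beta\<close> folded so that
      \<open>gseq\<close> matches; the second composes the iterates.\<close>
    using that by (simp add: gseq closed) (simp add: beta funpow_add)
  have "beta S k x a = left_prod S (\<lambda>i. (a [^]\<^bsub>inner_mapping_group S\<^esub> i) x) k" if "k \<ge> 1" for k
    using that beta_left_prod[OF x a] by (cases k) auto
  then show ?thesis
    \<comment> \<open>The two keys are the two orders of \<open>m\<close> and \<open>n\<close>,
      joined by commutativity of addition.\<close>
    using key[OF assms(4,5)] key[OF assms(5,4)] by (simp add: add.commute)
qed

end
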